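(* Let $h\ge 2$ and $m$ be positive integers. Let $A$ be a subset of an additive abelian group $G$ with $m$ elements, and let $A \cap (- A) \neq \varnothing$. Then the following hold. (1) If $|2_{\pm}A| = 4m - 2|A \cap (- A)| - 1 < p(G) - 1$, then $A \cup (- A)$ is an arithmetic progression. (2) If $h \geq 3$ and $|h_{\pm}A| = 2hm - h|A \cap (- A)| - h + 1 < p(G)$, then $A \cup (- A)$ is an arithmetic progression.
   Context: The group $G$ is nontrivial and need not be finite. For a finite subset $A=\{a_1,\dots,a_k\}$ (with $|A|=k$) of $G$ and a positive integer $h$, write $-A=\{-a:a\in A\}$ and $h_{\pm}A=\{\sum_{i=1}^k\lambda_i a_i:\lambda_i\in\mathbb{Z}\cap[-h,h],\ \sum_{i=1}^k|\lambda_i|=h\}$. $p(G)$ denotes the order of the smallest nontrivial subgroup of $G$, or $\infty$ if no such (finite) subgroup exists (with $\infty-1=\infty$). A set $B\subseteq G$ is an arithmetic progression ($k$-term, with common difference $d$) if $B=\{a+id:0\le i\le k-1\}$ for some $a\in G$ and some nonzero $d\in G$, where $k=|B|$. *)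

theory Defs
  imports Main "HOL-Library.Extended_Nat"
begin

definition int_mult :: "int \<Rightarrow> 'a::ab_group_add \<Rightarrow> 'a" (infixr "\<cdot>\<^sub>z" 75) where
  "k \<cdot>\<^sub>z x = (if 0 \<le> k then (\<Sum>i<nat k. x) else - (\<Sum>i<nat (- k). x))"

text \<open>The coefficient family is indexed by the elements of the finite set \<open>A\<close> itself; the
  values of \<open>l\<close> outside \<open>A\<close> are irrelevant.\<close>

definition signed_sumset :: "nat \<Rightarrow> 'a::ab_group_add set \<Rightarrow> 'a set" where
  "signed_sumset h A =
     {\<Sum>a\<in>A. l a \<cdot>\<^sub>z a | l :: 'a \<Rightarrow> int.
        (\<forall>a\<in>A. l a \<in> {- int h..int h}) \<and> (\<Sum>a\<in>A. \<bar>l a\<bar>) = int h}"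

definition additive_subgroup :: "'a::ab_group_add set \<Rightarrow> bool" where
  "additive_subgroup H \<longleftrightarrow>
     0 \<in> H \<and> (\<forall>x\<in>H. \<forall>y\<in>H. x + y \<in> H) \<and> (\<forall>x\<in>H. - x \<in> H)"

text \<open>\<open>p(G)\<close> for the group \<open>G\<close> of all elements of the type; only finite subgroups are collected,
  and the infimum of the empty set in \<^typ>\<open>enat\<close> is \<open>\<infinity>\<close>.\<close>

definition min_subgroup_order :: "'a::ab_group_add itself \<Rightarrow> enat" where
  "min_subgroup_order _ =
     Inf {enat (card H) | H :: 'a set. additive_subgroup H \<and> H \<noteq> {0} \<and> finite H}"

definition arithmetic_progression :: "'a::ab_group_add set \<Rightarrow> bool" where
  "arithmetic_progression B \<longleftrightarrow>
     (\<exists>a d. d \<noteq> 0 \<and> B = {a + int i \<cdot>\<^sub>z d | i. i < card B})"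

end

theory Submission
  imports Defs "HOL-Library.Set_Algebras"
begin

text \<open>
  Put \<open>B = A \<union> (- A)\<close>, \<open>n = |B|\<close> and \<open>p = p(G)\<close>. By inclusion and exclusion
  \<open>n = 2 m - |A \<inter> (- A)|\<close>, so the two hypotheses say \<open>|h\<^sub>\<plusminus>A| = h n - h + 1\<close>, for \<open>h = 2\<close> and
  for \<open>h \<ge> 3\<close>.

  The signed sumset contains the ordinary \<open>h\<close>-fold sumset \<open>hB\<close>: if a sum of \<open>h\<close> elements of
  \<open>B\<close> involves both \<open>a\<close> and \<open>- a\<close> they may cancel, but then the total weight only drops by an even
  amount, and a pair \<open>c, - c \<in> A\<close> can absorb it, since weight two can be added there without
  changing the sum (\<open>iterated_sumset_subset_signed_sumset\<close>). Hence \<open>|hB| \<le> h n - h + 1\<close>, which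
  is the least value that the Cauchy-Davenport inequality
  \<open>|X + Y| \<ge> min p (|X| + |Y| - 1)\<close> permits. Applied \<open>h - 2\<close> times, the inequality gives
  \<open>|hB| \<ge> |2B| + (h - 2) (n - 1)\<close>. So in both cases \<open>|2B| \<le> 2 n - 1\<close>, while \<open>2 n < p\<close> (unless
  \<open>n = 1\<close>, where there is nothing to prove).

  What remains is a Vosper theorem for a symmetric set. Over the integers modulo a prime, Vosper's
  theorem passes to complements, which are useless here because \<open>G\<close> may be infinite or
  much larger than \<open>p\<close>. The argument is therefore split in two. First, if
  \<open>|X + Y| = |X| + |Y| - 1 < p\<close> then the \<^emph>\<open>sumset\<close> \<open>X + Y\<close> is a progression
  (\<open>vosper_sumset\<close>): the Dyson e-transform shrinks \<open>Y\<close> down to two elements without changing the sumset,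
  and this weaker conclusion makes the induction immediate. Second, \<open>B\<close> is symmetric, so \<open>B + B\<close>
  is also the difference set \<open>B - B\<close>; it is \<open>{i d | |i| < n}\<close>, and the absence of the
  differences \<open>n d\<close> and \<open>(n + 1) d\<close> forces the \<open>n\<close> elements of \<open>B\<close> to be consecutive
  (\<open>int_set_interval\<close>).
\<close>

section \<open>Integer multiples and finite subgroups\<close>
lemma int_mult_zero [simp]: "0 \<cdot>\<^sub>z (x::'a::ab_group_add) = 0"
  by (simp add: int_mult_def)

lemma int_mult_one [simp]: "1 \<cdot>\<^sub>z (x::'a::ab_group_add) = x"
  by (simp add: int_mult_def)

lemma int_mult_minus: "(- k) \<cdot>\<^sub>z (x::'a::ab_group_add) = - (k \<cdot>\<^sub>z x)"
  by (simp add: int_mult_def)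

lemma int_mult_succ: "(k + 1) \<cdot>\<^sub>z (x::'a::ab_group_add) = k \<cdot>\<^sub>z x + x"
proof (cases "0 \<le> k")
  case True
  then have "nat (k + 1) = Suc (nat k)" by simp
  with True show ?thesis by (simp add: int_mult_def add.commute)
next
  case False
  then have "nat (- k) = Suc (nat (- (k + 1)))" by simp
  with False show ?thesis
    by (cases "k = -1") (simp_all add: int_mult_def algebra_simps)
qed

lemma int_mult_add: "(j + k) \<cdot>\<^sub>z (x::'a::ab_group_add) = j \<cdot>\<^sub>z x + k \<cdot>\<^sub>z x"
proof (induction k rule: int_induct[where k = 0])
  case base
  show ?case by simp
next
  case (step1 i)
  then show ?case
    using int_mult_succ[of "j + i" x] int_mult_succ[of i x] by (simp add: algebra_simps)
next
  case (step2 i)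
  then show ?case
    using int_mult_succ[of "j + i - 1" x] int_mult_succ[of "i - 1" x]
    by (simp add: algebra_simps)
qed

lemma int_mult_diff: "(j - k) \<cdot>\<^sub>z (x::'a::ab_group_add) = j \<cdot>\<^sub>z x - k \<cdot>\<^sub>z x"
  using int_mult_add[of j "- k" x] by (simp add: int_mult_minus)

lemma int_mult_right_minus: "k \<cdot>\<^sub>z (- (x::'a::ab_group_add)) = - (k \<cdot>\<^sub>z x)"
  by (simp add: int_mult_def sum_negf)

text \<open>
  The elements \<open>g\<close> with \<open>C + g \<subseteq> C\<close> form a subgroup, because on a finite set such a translation
  is a permutation. It contains \<open>d\<close>, and a translate of it lies inside \<open>C\<close>. This is the only way
  in which \<open>p(G)\<close> enters the whole argument.
\<close>
lemma min_subgroup_order_le_card_invariant: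
  fixes C :: "'a::ab_group_add set"
  assumes fin: "finite C" and ne: "C \<noteq> {}" and d: "d \<noteq> 0"
    and inv: "\<And>c. c \<in> C \<Longrightarrow> c + d \<in> C"
  shows "min_subgroup_order TYPE('a) \<le> enat (card C)"
proof -
  define H where "H = {g. \<forall>c\<in>C. c + g \<in> C}"
  obtain c0 where c0: "c0 \<in> C" using ne by blast
  have sub: "(+) c0 ` H \<subseteq> C" using c0 by (auto simp: H_def)
  have finH: "finite H" and cardH: "card H \<le> card C"
    using sub fin by (meson finite_imageD finite_subset inj_on_add,
        metis card_image card_mono inj_on_add)
  have neg: "- g \<in> H" if "g \<in> H" for g
  proof -
    have "(\<lambda>c. c + g) ` C = C"
      by (rule endo_inj_surj) (use fin that in \<open>auto simp: H_def\<close>)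
    then have "\<exists>c'\<in>C. c = c' + g" if "c \<in> C" for c
      using that by blast
    then show ?thesis by (force simp: H_def)
  qed
  have "additive_subgroup H"
    unfolding additive_subgroup_def
  proof (intro conjI ballI)
    show "0 \<in> H" by (simp add: H_def)
    show "x + y \<in> H" if "x \<in> H" "y \<in> H" for x y
      using that by (simp add: H_def add.assoc [symmetric])
  qed (rule neg)
  moreover have "H \<noteq> {0}" using inv d by (auto simp: H_def)
  ultimately have "min_subgroup_order TYPE('a) \<le> enat (card H)"
    unfolding min_subgroup_order_def using finH by (intro Inf_lower) blast
  also have "\<dots> \<le> enat (card C)" using cardH by simp
  finally show ?thesis .
qed

text \<open>If \<open>i d = 0\<close>, the multiples \<open>0, d, \<dots>, (i - 1) d\<close> are invariant under adding \<open>d\<close>.\<close>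
lemma int_mult_neq_zero:
  fixes d :: "'a::ab_group_add"
  assumes d: "d \<noteq> 0" and i: "0 < i" and lt: "enat (nat i) < min_subgroup_order TYPE('a)"
  shows "i \<cdot>\<^sub>z d \<noteq> 0"
proof
  assume eq: "i \<cdot>\<^sub>z d = 0"
  let ?C = "(\<lambda>j. j \<cdot>\<^sub>z d) ` {0..<i}"
  have "c + d \<in> ?C" if "c \<in> ?C" for c
  proof -
    obtain j where j: "0 \<le> j" "j < i" "c = j \<cdot>\<^sub>z d" using \<open>c \<in> ?C\<close> by auto
    show ?thesis
    proof (cases "j + 1 = i")
      case True
      then have "c + d = 0 \<cdot>\<^sub>z d" using j eq int_mult_succ[of j d] by simp
      then show ?thesis using i by (intro image_eqI[where x = 0]) auto
    next
      case False
      then show ?thesis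
        using j int_mult_succ[of j d] by (intro image_eqI[where x = "j + 1"]) auto
    qed
  qed
  then have "min_subgroup_order TYPE('a) \<le> enat (card ?C)"
    using i d by (intro min_subgroup_order_le_card_invariant[of _ d]) auto
  also have "card ?C \<le> nat i"
    using card_image_le[of "{0..<i}" "\<lambda>j. j \<cdot>\<^sub>z d"] by simp
  finally show False using lt by (simp add: leD)
qed

section \<open>The Cauchy-Davenport inequality\<close>
lemma card_translate: "card ((\<lambda>x. x + g) ` X) = card (X::'a::ab_group_add set)"
  by (rule card_image) simp

lemma card_le_card_sumset:
  fixes X Y :: "'a::ab_group_add set"
  assumes "finite X" "finite Y" "Y \<noteq> {}"
  shows "card X \<le> card (X + Y)"
proof -
  obtain y where "y \<in> Y" using assms by blast
  then have "(\<lambda>x. x + y) ` X \<subseteq> X + Y" by (auto intro: set_plus_intro)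
  then show ?thesis using card_mono[OF finite_set_plus] assms card_translate by metis
qed

text \<open>
  Dyson's e-transform moves elements from \<open>Y\<close> to \<open>X\<close>. It preserves the total size because
  \<open>Y' + e\<close> is the intersection of \<open>X\<close> and \<open>Y + e\<close>, and the sumset does not grow because
  \<open>(y\<^sub>2 + e) + y = (y + e) + y\<^sub>2\<close>, where \<open>y + e \<in> X\<close>.
\<close>
lemma e_transform:
  fixes X Y :: "'a::ab_group_add set"
  defines "X' \<equiv> \<lambda>e. X \<union> (\<lambda>y. y + e) ` Y" and "Y' \<equiv> \<lambda>e. Y \<inter> {y. y + e \<in> X}"
  assumes fin: "finite X" "finite Y"
  shows e_transform_card: "card (X' e) + card (Y' e) = card X + card Y"
    and e_transform_sumset: "X' e + Y' e \<subseteq> X + Y"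
proof -
  have "X \<inter> (\<lambda>y. y + e) ` Y = (\<lambda>y. y + e) ` Y' e" by (auto simp: Y'_def)
  then show "card (X' e) + card (Y' e) = card X + card Y"
    using card_Un_Int[of X "(\<lambda>y. y + e) ` Y"] fin by (simp add: X'_def card_translate)
  show "X' e + Y' e \<subseteq> X + Y"
  proof
    fix z assume "z \<in> X' e + Y' e"
    then obtain x y where z: "z = x + y" "x \<in> X' e" "y \<in> Y' e" by (auto elim: set_plus_elim)
    show "z \<in> X + Y"
    proof (cases "x \<in> X")
      case True
      then show ?thesis using z by (auto simp: Y'_def intro: set_plus_intro)
    next
      case False
      then obtain y2 where y2: "y2 \<in> Y" "x = y2 + e" using z by (auto simp: X'_def)
      then have "z = (y + e) + y2" using z by (simp add: algebra_simps)
      also have "\<dots> \<in> X + Y" using y2 z by (intro set_plus_intro) (auto simp: Y'_def)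
      finally show ?thesis .
    qed
  qed
qed

text \<open>
  Some e-transform with \<open>e \<in> X\<close> makes \<open>Y\<close> strictly smaller: otherwise \<open>X\<close> is invariant under a
  nonzero element of \<open>Y\<close> and so has at least \<open>p(G)\<close> elements. The element \<open>0\<close> stays in \<open>Y\<close>, which
  keeps \<open>Y\<close> nonempty in the induction.
\<close>
lemma cauchy_davenport_zero:
  fixes X Y :: "'a::ab_group_add set"
  assumes "finite X" "X \<noteq> {}" "finite Y" "0 \<in> Y"
    and "enat (card (X + Y)) < min_subgroup_order TYPE('a)"
  shows "card X + card Y \<le> card (X + Y) + 1"
  using assms
proof (induction "card Y" arbitrary: X Y rule: less_induct)
  case less
  show ?case
  proof (cases "Y = {0}")
    case True
    then show ?thesis using card_le_card_sumset[of X Y] less.prems by simp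
  next
    case False
    then obtain d where d: "d \<in> Y" "d \<noteq> 0" using less.prems by auto
    have le: "card X \<le> card (X + Y)"
      using card_le_card_sumset[of X Y] less.prems by auto
    have "\<exists>e\<in>X. e + d \<notin> X"
    proof (rule ccontr)
      assume "\<not> ?thesis"
      then have "min_subgroup_order TYPE('a) \<le> enat (card X)"
        using d less.prems by (intro min_subgroup_order_le_card_invariant[of X d]) auto
      also have "\<dots> \<le> enat (card (X + Y))" using le by simp
      finally show False using less.prems by (simp add: leD)
    qed
    then obtain e where e: "e \<in> X" "e + d \<notin> X" by blast
    define X' where "X' = X \<union> (\<lambda>y. y + e) ` Y"
    define Y' where "Y' = Y \<inter> {y. y + e \<in> X}"
    have sub: "X' + Y' \<subseteq> X + Y" and card: "card X' + card Y' = card X + card Y"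
      using e_transform[OF less.prems(1,3), of e] by (simp_all add: X'_def Y'_def)
    have mono: "card (X' + Y') \<le> card (X + Y)"
      using sub less.prems by (simp add: card_mono finite_set_plus)
    have "d \<notin> Y'" using e by (simp add: Y'_def add.commute)
    then have "card Y' < card Y"
      using d less.prems by (intro psubset_card_mono) (auto simp: Y'_def)
    moreover have "enat (card (X' + Y')) < min_subgroup_order TYPE('a)"
      using mono less.prems(5) by (meson enat_ord_simps(1) le_less_trans)
    ultimately have "card X' + card Y' \<le> card (X' + Y') + 1"
      using less.prems e by (intro less.hyps) (auto simp: X'_def Y'_def)
    then show ?thesis using card mono by linarith
  qed
qed

lemma sumset_translate:
  fixes X Y :: "'a::ab_group_add set"
  shows "X + (\<lambda>y. y + g) ` Y = (\<lambda>z. z + g) ` (X + Y)"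
  by (force simp: set_plus_def image_def algebra_simps)

theorem cauchy_davenport:
  fixes X Y :: "'a::ab_group_add set"
  assumes "finite X" "X \<noteq> {}" "finite Y" "Y \<noteq> {}"
    and "enat (card (X + Y)) < min_subgroup_order TYPE('a)"
  shows "card X + card Y \<le> card (X + Y) + 1"
proof -
  obtain y where "y \<in> Y" using assms by blast
  then have "0 \<in> (\<lambda>z. z + - y) ` Y" by force
  then show ?thesis
    using cauchy_davenport_zero[of X "(\<lambda>z. z + - y) ` Y"] assms
    unfolding sumset_translate card_translate by simp
qed

section \<open>Extremal pairs have a progression as sumset\<close>

text \<open>
  Exactly one element \<open>x\<^sub>0\<close> of \<open>X\<close> has no predecessor \<open>x\<^sub>0 - d\<close> in \<open>X\<close>. The set \<open>X\<close> is then
  the single run that starts at \<open>x\<^sub>0\<close>, since what is left over after removing an initial part of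
  the run is too small to be closed under subtracting \<open>d\<close>.
\<close>
lemma sumset_pair_progression:
  fixes X :: "'a::ab_group_add set"
  assumes fin: "finite X" and ne: "X \<noteq> {}" and d: "d \<noteq> 0"
    and card: "card (X + {0, d}) = card X + 1"
    and small: "enat (card (X + {0, d})) < min_subgroup_order TYPE('a)"
  shows "arithmetic_progression (X + {0, d})"
proof -
  let ?P = "min_subgroup_order TYPE('a)"
  have small': "enat (card C) < ?P" if "C \<subseteq> X" for C
    using card_mono[OF fin that] card small by (auto intro: le_less_trans[rotated])
  have XU: "X + {0, d} = X \<union> (\<lambda>x. x + d) ` X"
    by (force simp: set_plus_def)
  have nodminus: "\<exists>x\<in>C. x - d \<notin> C" if "C \<subseteq> X" "C \<noteq> {}" for C
    using min_subgroup_order_le_card_invariant[of C "- d"] small'[OF that(1)] that d fin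
    by (metis finite_subset leD neg_equal_0_iff_equal uminus_add_conv_diff add.commute)
  have "card (X - (\<lambda>x. x + d) ` X) = 1"
    using card_Un_disjoint[of "X - (\<lambda>x. x + d) ` X" "(\<lambda>x. x + d) ` X"] card XU fin
    by (simp add: card_translate Diff_Int_distrib2 Int_Diff)
  then obtain x0 where x0: "X - (\<lambda>x. x + d) ` X = {x0}" by (auto simp: card_1_singleton_iff)
  have start: "x = x0" if "x \<in> X" "x - d \<notin> X" for x
  proof -
    have "x \<notin> (\<lambda>x. x + d) ` X" using that by (auto simp: algebra_simps)
    then show ?thesis using x0 that by blast
  qed
  define R where "R k = {x0 + int i \<cdot>\<^sub>z d | i. i < k}" for k
  have RSuc: "R (Suc k) = insert (x0 + int k \<cdot>\<^sub>z d) (R k)" for k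
    by (auto simp: R_def less_Suc_eq)
  have run: "k \<le> card X \<Longrightarrow> R k \<subseteq> X \<and> finite (R k) \<and> card (R k) = k" for k
  proof (induction k)
    case 0
    show ?case by (simp add: R_def)
  next
    case (Suc k)
    then have IH: "R k \<subseteq> X" "finite (R k)" "card (R k) = k" by simp_all
    have "X - R k \<noteq> {}" using IH Suc.prems fin
      by (metis Diff_eq_empty_iff card_mono not_less_eq_eq)
    then obtain x where x: "x \<in> X" "x \<notin> R k" "x - d \<notin> X - R k"
      using nodminus[of "X - R k"] by auto
    (* The predecessor of x is missing altogether, or it lies in the run built so far; in the
       latter case it must be the last element of that run. *)
    have "x = x0 + int k \<cdot>\<^sub>z d"
    proof (cases "x - d \<in> X")
      case True
      then obtain i where i: "i < k" "x - d = x0 + int i \<cdot>\<^sub>z d" using x by (auto simp: R_def)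
      then have xi: "x = x0 + int (Suc i) \<cdot>\<^sub>z d"
        using int_mult_succ[of "int i" d] by (simp add: algebra_simps)
      then have "\<not> Suc i < k" using x(2) by (auto simp: R_def)
      then show ?thesis using i xi by (metis not_less_eq less_antisym)
    next
      case False
      then have "x = x0" using start x by blast
      moreover from this have "k = 0" using x(2) by (force simp: R_def)
      ultimately show ?thesis by simp
    qed
    then show ?case using IH x by (simp add: RSuc)
  qed
  then have X: "X = R (card X)" using fin by (metis card_subset_eq order_refl)
  have "X + {0, d} = R (card X + 1)"
  proof -
    have shift: "x0 + int (Suc i) \<cdot>\<^sub>z d = (x0 + int i \<cdot>\<^sub>z d) + d" for i
      using int_mult_succ[of "int i" d] by (simp add: algebra_simps)
    have "R (k + 1) = R k \<union> (\<lambda>x. x + d) ` R k" if "0 < k" for k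
    proof (intro equalityI subsetI)
      fix x assume "x \<in> R (k + 1)"
      then obtain i where i: "i < k + 1" "x = x0 + int i \<cdot>\<^sub>z d" by (auto simp: R_def)
      show "x \<in> R k \<union> (\<lambda>x. x + d) ` R k"
      proof (cases i)
        case 0
        then show ?thesis using i that by (auto simp: R_def)
      next
        case (Suc j)
        then have "x = (x0 + int j \<cdot>\<^sub>z d) + d" "j < k" using i shift[of j] by simp_all
        then show ?thesis by (auto simp: R_def)
      qed
    next
      fix x assume "x \<in> R k \<union> (\<lambda>x. x + d) ` R k"
      then consider i where "i < k" "x = x0 + int i \<cdot>\<^sub>z d"
        | i where "i < k" "x = (x0 + int i \<cdot>\<^sub>z d) + d" by (auto simp: R_def)
      then show "x \<in> R (k + 1)"
      proof cases
        case 1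
        then show ?thesis unfolding R_def by (intro CollectI exI[of _ i]) simp
      next
        case 2
        then show ?thesis unfolding R_def
          by (intro CollectI exI[of _ "Suc i"]) (simp only: shift, simp)
      qed
    qed
    then show ?thesis using X XU ne fin by (metis card_gt_0_iff)
  qed
  then show ?thesis
    unfolding arithmetic_progression_def card R_def using d by blast
qed

text \<open>
  The induction on \<open>Y\<close> needs an e-transform that shrinks \<open>Y\<close> but leaves it at least two elements.
  Suppose there is none, and let \<open>E\<close> be the set of \<open>e \<in> X\<close> with \<open>e + Y\<close> not contained in \<open>X\<close>. For
  \<open>e \<in> E\<close> only \<open>0\<close> survives in \<open>Y\<close>, so \<open>E + (Y - {0})\<close> is disjoint from \<open>X\<close>; as \<open>X + Y\<close> has
  only \<open>|Y| - 1\<close> elements outside \<open>X\<close>, Cauchy-Davenport leaves room for at most one element in \<open>E\<close>.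
  On the other hand \<open>(X - E) + Y \<subseteq> X\<close>, and Cauchy-Davenport gives \<open>|E| \<ge> |Y| - 1 \<ge> 2\<close>.
\<close>
lemma proper_e_transform_exists:
  fixes X Y :: "'a::ab_group_add set"
  assumes fin: "finite X" "finite Y" and zero: "0 \<in> Y"
    and X: "2 \<le> card X" and Y: "3 \<le> card Y"
    and card: "card (X + Y) + 1 = card X + card Y"
    and small: "enat (card (X + Y)) < min_subgroup_order TYPE('a)"
  shows "\<exists>e\<in>X. 2 \<le> card (Y \<inter> {y. y + e \<in> X}) \<and> \<not> Y \<subseteq> {y. y + e \<in> X}"
proof (rule ccontr)
  assume contra: "\<not> ?thesis"
  have small': "enat (card Z) < min_subgroup_order TYPE('a)" if "Z \<subseteq> X + Y" for Z
    using card_mono[OF finite_set_plus[OF fin] that] small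
    by (meson enat_ord_simps(1) le_less_trans)
  have XXY: "X \<subseteq> X + Y" using set_plus_intro[of _ X 0 Y] zero by auto
  define E where "E = {e\<in>X. \<not> Y \<subseteq> {y. y + e \<in> X}}"
  define Z where "Z = Y - {0}"
  have finE: "finite E" "finite Z" using fin by (auto simp: E_def Z_def)
  have cardZ: "card Z + 1 = card Y" using zero fin Y by (simp add: Z_def card_Diff_singleton)
  then have Zne: "Z \<noteq> {}" using Y by auto
  have out: "e + y \<notin> X" if "e \<in> E" "y \<in> Z" for e y
  proof
    assume "e + y \<in> X"
    then have "{0, y} \<subseteq> Y \<inter> {y. y + e \<in> X}"
      using that zero by (auto simp: E_def Z_def add.commute)
    then have "card {0, y} \<le> card (Y \<inter> {y. y + e \<in> X})"
      using fin by (intro card_mono) auto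
    then show False using that contra by (auto simp: E_def Z_def)
  qed
  have disj: "X \<inter> (E + Z) = {}" using out by (auto elim: set_plus_elim)
  have EZ: "E + Z \<subseteq> X + Y" by (intro set_plus_mono2) (auto simp: E_def Z_def)
  have "card X + card (E + Z) = card (X \<union> (E + Z))"
    using disj fin finE by (simp add: card_Un_disjoint finite_set_plus)
  also have "\<dots> \<le> card (X + Y)" using EZ XXY fin by (simp add: card_mono finite_set_plus)
  finally have "card X + card (E + Z) \<le> card (X + Y)" .
  moreover have "card E + card Z \<le> card (E + Z) + 1" if "E \<noteq> {}"
    using cauchy_davenport[of E Z] that Zne finE small'[OF EZ] by simp
  ultimately have E1: "card E \<le> 1" using card cardZ by (cases "E = {}") auto
  have EX: "E \<subseteq> X" by (auto simp: E_def)
  have cardX: "card X = card (X - E) + card E"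
    using card_Diff_subset[OF finE(1) EX] card_mono[OF fin(1) EX] by simp
  then have "card (X - E) \<noteq> 0" using E1 X by linarith
  then have "X - E \<noteq> {}" by force
  moreover have stay: "(X - E) + Y \<subseteq> X"
    by (auto simp: E_def set_plus_def add.commute)
  ultimately have "card (X - E) + card Y \<le> card ((X - E) + Y) + 1"
    using fin zero XXY by (intro cauchy_davenport small') auto
  also have "card ((X - E) + Y) \<le> card X" using stay fin by (simp add: card_mono)
  finally show False using cardX E1 Y by linarith
qed

text \<open>
  After a proper e-transform the Cauchy-Davenport inequality for the new pair is again tight, so its
  sumset is not merely contained in \<open>X + Y\<close> but equal to it. The induction thus hands down the same
  set until \<open>Y\<close> is a pair.
\<close>
lemma vosper_sumset_zero:
  fixes X Y :: "'a::ab_group_add set"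
  assumes "finite X" "finite Y" "0 \<in> Y" "2 \<le> card X" "2 \<le> card Y"
    and "card (X + Y) + 1 = card X + card Y"
    and "enat (card (X + Y)) < min_subgroup_order TYPE('a)"
  shows "arithmetic_progression (X + Y)"
  using assms
proof (induction "card Y" arbitrary: X Y rule: less_induct)
  case less
  show ?case
  proof (cases "card Y = 2")
    case True
    then obtain d where "Y = {0, d}" "d \<noteq> 0"
      using less.prems(3) by (auto simp: card_2_iff)
    moreover have "X \<noteq> {}" using less.prems(4) by auto
    ultimately show ?thesis
      using sumset_pair_progression[of X d] less.prems True by auto
  next
    case False
    then have "3 \<le> card Y" using less.prems by simp
    then obtain e where e: "e \<in> X" "2 \<le> card (Y \<inter> {y. y + e \<in> X})" "\<not> Y \<subseteq> {y. y + e \<in> X}"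
      using proper_e_transform_exists[of X Y] less.prems by blast
    define X' where "X' = X \<union> (\<lambda>y. y + e) ` Y"
    define Y' where "Y' = Y \<inter> {y. y + e \<in> X}"
    have sub: "X' + Y' \<subseteq> X + Y" and card: "card X' + card Y' = card X + card Y"
      using e_transform[OF less.prems(1,2), of e] by (simp_all add: X'_def Y'_def)
    have fin: "finite X'" "finite Y'" using less.prems by (auto simp: X'_def Y'_def)
    have finS: "finite (X + Y)" using less.prems by (simp add: finite_set_plus)
    have mono: "card (X' + Y') \<le> card (X + Y)" using sub finS by (rule card_mono[rotated])
    then have small: "enat (card (X' + Y')) < min_subgroup_order TYPE('a)"
      using less.prems(7) by (meson enat_ord_simps(1) le_less_trans)
    have zero: "0 \<in> Y'" using e less.prems by (simp add: Y'_def)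
    have "card X' + card Y' \<le> card (X' + Y') + 1"
      using e zero by (intro cauchy_davenport fin small) (auto simp: X'_def)
    then have eq: "card (X' + Y') = card (X + Y)" using mono card less.prems by linarith
    then have same: "X' + Y' = X + Y" using card_subset_eq[OF finS sub] by simp
    have "card Y' < card Y"
      using e less.prems by (intro psubset_card_mono) (auto simp: Y'_def)
    moreover have "card X \<le> card X'" using fin by (intro card_mono) (auto simp: X'_def)
    ultimately have "arithmetic_progression (X' + Y')"
      using less.prems card eq e fin zero small by (intro less.hyps) (auto simp: Y'_def)
    then show ?thesis using same by simp
  qed
qed

lemma arithmetic_progression_translate:
  fixes S :: "'a::ab_group_add set"
  assumes "arithmetic_progression ((\<lambda>x. x + g) ` S)"
  shows "arithmetic_progression S"
proof -
  obtain a d where d: "d \<noteq> 0"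
    and S: "(\<lambda>x. x + g) ` S = {a + int i \<cdot>\<^sub>z d | i. i < card S}"
    using assms by (auto simp: arithmetic_progression_def card_translate)
  have "S = (\<lambda>x. x - g) ` (\<lambda>x. x + g) ` S" by (simp add: image_image)
  also have "\<dots> = {(a - g) + int i \<cdot>\<^sub>z d | i. i < card S}"
    unfolding S by (force simp: algebra_simps)
  finally show ?thesis using d unfolding arithmetic_progression_def by blast
qed

theorem vosper_sumset:
  fixes X Y :: "'a::ab_group_add set"
  assumes "finite X" "finite Y" "2 \<le> card X" "2 \<le> card Y"
    and "card (X + Y) + 1 = card X + card Y"
    and "enat (card (X + Y)) < min_subgroup_order TYPE('a)"
  shows "arithmetic_progression (X + Y)"
proof -
  obtain y where "y \<in> Y" using assms by fastforce
  then have "0 \<in> (\<lambda>z. z + - y) ` Y" by force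
  then have "arithmetic_progression (X + (\<lambda>z. z + - y) ` Y)"
    using assms by (intro vosper_sumset_zero) (simp_all only: sumset_translate card_translate finite_imageI)
  then show ?thesis
    unfolding sumset_translate by (rule arithmetic_progression_translate)
qed

section \<open>Recovering a set from its difference set\<close>

text \<open>
  Since \<open>0 \<in> S\<close>, the progression is \<open>{i d | - k \<le> i \<le> l}\<close> with \<open>k + l = 2 n\<close>. If one side is longer,
  it contains the multiple of \<open>d\<close> just beyond the end of the shorter side, and the negative of that
  one is not in \<open>S\<close>, because the order of \<open>d\<close> exceeds \<open>2 n + 1\<close>.
\<close>
lemma symmetric_progression_centred:
  fixes S :: "'a::ab_group_add set"
  assumes ap: "arithmetic_progression S" and card: "card S = 2 * n + 1"
    and zero: "0 \<in> S" and sym: "\<And>s. s \<in> S \<Longrightarrow> - s \<in> S"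
    and small: "enat (2 * n + 1) < min_subgroup_order TYPE('a)"
  shows "\<exists>d. d \<noteq> 0 \<and> S = {i \<cdot>\<^sub>z d | i. \<bar>i\<bar> \<le> int n}"
proof -
  obtain a d where d: "d \<noteq> 0" and S: "S = {a + int i \<cdot>\<^sub>z d | i. i < 2 * n + 1}"
    using ap card by (auto simp: arithmetic_progression_def)
  have nz: "i \<cdot>\<^sub>z d \<noteq> 0" if "0 < i" "i \<le> 2 * int n + 1" for i
  proof -
    have "enat (nat i) \<le> enat (2 * n + 1)" using that by simp
    then show ?thesis using int_mult_neq_zero[OF d that(1)] small by (meson le_less_trans)
  qed
  obtain k where k: "k < 2 * n + 1" "0 = a + int k \<cdot>\<^sub>z d" using zero S by auto
  define l where "l = int (2 * n) - int k"
  have a: "a = - (int k \<cdot>\<^sub>z d)" using k(2) by (metis eq_neg_iff_add_eq_0)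
  have S': "x \<in> S \<longleftrightarrow> (\<exists>i. - int k \<le> i \<and> i \<le> l \<and> x = i \<cdot>\<^sub>z d)" for x
  proof
    assume "x \<in> S"
    then obtain i where "i < 2 * n + 1" "x = a + int i \<cdot>\<^sub>z d" using S by blast
    then show "\<exists>i. - int k \<le> i \<and> i \<le> l \<and> x = i \<cdot>\<^sub>z d"
      by (intro exI[of _ "int i - int k"]) (auto simp: l_def a int_mult_diff)
  next
    assume "\<exists>i. - int k \<le> i \<and> i \<le> l \<and> x = i \<cdot>\<^sub>z d"
    then obtain i where "- int k \<le> i" "i \<le> l" "x = i \<cdot>\<^sub>z d" by blast
    then have "x = a + int (nat (i + int k)) \<cdot>\<^sub>z d" "nat (i + int k) < 2 * n + 1"
      by (auto simp: l_def a int_mult_add)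
    then show "x \<in> S" using S by blast
  qed
  have "l = int k"
  proof (rule ccontr)
    assume "l \<noteq> int k"
    then consider "int k < l" | "l < int k" by linarith
    then show False
    proof cases
      case 1
      then have "(int k + 1) \<cdot>\<^sub>z d \<in> S" unfolding S' by (intro exI[of _ "int k + 1"]) auto
      then have "- ((int k + 1) \<cdot>\<^sub>z d) \<in> S" by (rule sym)
      then obtain i where "- int k \<le> i" "i \<le> l" "- ((int k + 1) \<cdot>\<^sub>z d) = i \<cdot>\<^sub>z d"
        unfolding S' by blast
      moreover from this have "(i + (int k + 1)) \<cdot>\<^sub>z d = 0"
        by (subst int_mult_add) (metis left_minus)
      ultimately show False using nz[of "i + (int k + 1)"] by (auto simp: l_def)
    next
      case 2
      then have "(- (l + 1)) \<cdot>\<^sub>z d \<in> S" unfolding S' using k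
        by (intro exI[of _ "- (l + 1)"]) (auto simp: l_def)
      then have "- ((- (l + 1)) \<cdot>\<^sub>z d) \<in> S" by (rule sym)
      then obtain i where "- int k \<le> i" "i \<le> l" "(l + 1) \<cdot>\<^sub>z d = i \<cdot>\<^sub>z d"
        unfolding S' int_mult_minus by auto
      then show False using nz[of "(l + 1) - i"]
        by (auto simp: l_def int_mult_diff)
    qed
  qed
  then have "int k = int n" "l = int n" by (auto simp: l_def)
  then have "x \<in> S \<longleftrightarrow> (\<exists>i. \<bar>i\<bar> \<le> int n \<and> x = i \<cdot>\<^sub>z d)" for x
    unfolding S' abs_le_iff by (metis minus_le_iff)
  then have "S = {i \<cdot>\<^sub>z d | i. \<bar>i\<bar> \<le> int n}" by blast
  then show ?thesis using d by blast
qed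

text \<open>
  No two elements of \<open>I\<close> differ by \<open>n\<close>, so the \<open>n\<close> elements of \<open>I\<close> represent every residue class
  modulo \<open>n\<close> exactly once. For a negative \<open>j \<in> I\<close> the class of \<open>j + 1\<close> can only be represented by
  \<open>j + 1\<close> or \<open>j + 1 + n\<close>, and the latter is at distance \<open>n + 1\<close> from \<open>j\<close>; hence \<open>j + 1 \<in> I\<close>.
  Positive elements propagate downwards in the same way, so \<open>I\<close> has no holes.
\<close>
lemma int_set_interval:
  fixes I :: "int set" and n :: nat
  assumes bound: "\<And>i. i \<in> I \<Longrightarrow> \<bar>i\<bar> < int n" and zero: "0 \<in> I" and card: "card I = n"
    and gap: "\<And>i j. i \<in> I \<Longrightarrow> j \<in> I \<Longrightarrow> i - j \<noteq> int n \<and> i - j \<noteq> int n + 1"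
  shows "\<exists>s. I = {s..<s + int n}"
proof -
  have fin: "finite I" by (rule finite_subset[of _ "{- int n..int n}"]) (use bound in force)+
  have n: "0 < int n" using bound[OF zero] by simp
  have "inj_on (\<lambda>i. i mod int n) I"
  proof (rule inj_onI, rule ccontr)
    fix i j assume ij: "i \<in> I" "j \<in> I" "i mod int n = j mod int n" "i \<noteq> j"
    then obtain q where q: "i - j = int n * q" by (metis mod_eq_dvd_iff dvd_def)
    have "\<bar>int n * q\<bar> < int n * 2" using bound[OF ij(1)] bound[OF ij(2)] q by linarith
    then have "\<bar>q\<bar> < 2" using n by (simp add: abs_mult)
    moreover have "q \<noteq> 0" using q ij by auto
    ultimately have "q = 1 \<or> q = -1" by linarith
    then have "i - j = int n \<or> j - i = int n" using q by auto
    then show False using gap ij by blast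
  qed
  then have "card ((\<lambda>i. i mod int n) ` I) = n" using card by (simp add: card_image)
  moreover have "(\<lambda>i. i mod int n) ` I \<subseteq> {0..<int n}" using n by auto
  ultimately have res: "(\<lambda>i. i mod int n) ` I = {0..<int n}" by (intro card_subset_eq) auto
  have hit: "r \<in> I \<or> r + int n \<in> I \<or> r - int n \<in> I" if "\<bar>r\<bar> < int n" for r
  proof -
    have "r mod int n \<in> (\<lambda>i. i mod int n) ` I" using res n by simp
    then obtain i where i: "i \<in> I" "i mod int n = r mod int n" by auto
    then obtain q where q: "i - r = int n * q" by (metis mod_eq_dvd_iff dvd_def)
    have "\<bar>int n * q\<bar> < int n * 2" using bound[OF i(1)] that q by linarith
    then have "\<bar>q\<bar> < 2" using n by (simp add: abs_mult)
    then have "q = 0 \<or> q = 1 \<or> q = -1" by linarith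
    then have "i = r \<or> i = r + int n \<or> i = r - int n" using q by auto
    then show ?thesis using i by auto
  qed
  have up: "j + 1 \<in> I" if "j \<in> I" "j < 0" for j
    using hit[of "j + 1"] gap[of "j + 1 + int n" j] bound[of j] bound[of "j + 1 - int n"] that
    by auto
  have down: "i - 1 \<in> I" if "i \<in> I" "0 < i" for i
    using hit[of "i - 1"] gap[of i "i - 1 - int n"] bound[of i] bound[of "i - 1 + int n"] that
    by auto
  have neg: "x \<in> I" if "Min I \<le> x" "x \<le> 0" for x
    using that
  proof (induction x rule: int_ge_induct)
    case base
    then show ?case using fin zero by (auto intro: Min_in)
  next
    case (step i)
    then show ?case using up[of i] by simp
  qed
  have pos: "x \<in> I" if "x \<le> Max I" "0 \<le> x" for x
    using that
  proof (induction x rule: int_le_induct)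
    case base
    then show ?case using fin zero by (auto intro: Max_in)
  next
    case (step i)
    then show ?case using down[of i] by simp
  qed
  have I: "I = {Min I..Max I}"
  proof (intro equalityI subsetI)
    show "x \<in> {Min I..Max I}" if "x \<in> I" for x using fin that by simp
    show "x \<in> I" if "x \<in> {Min I..Max I}" for x
      using neg[of x] pos[of x] that by (cases "x \<le> 0") auto
  qed
  have "Min I \<le> 0" "0 \<le> Max I" using fin zero by auto
  moreover have "card I = nat (Max I + 1 - Min I)"
    using arg_cong[OF I, of card] by simp
  ultimately have "Max I + 1 = Min I + int n" using card by linarith
  then have "{Min I..Max I} = {Min I..<Min I + int n}"
    by (metis atLeastLessThanPlusOne_atLeastAtMost_int)
  then show ?thesis by (intro exI[of _ "Min I"] trans[OF I])
qed

text \<open>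
  Seen from a fixed \<open>b \<in> B\<close>, the set \<open>B\<close> is \<open>{b + i d | i \<in> I}\<close> with integers \<open>|i| < n\<close>. The order of \<open>d\<close>
  may be as small as \<open>2 n + 1\<close>, so a difference of two elements of \<open>I\<close> is known only modulo this order and
  could wrap around. The two values \<open>n\<close> and \<open>n + 1\<close> are excluded nevertheless, because
  they differ from each \<open>|t| < n\<close> by at least \<open>1\<close> and at most \<open>2 n\<close>.
\<close>
lemma progression_of_difference_set:
  fixes B :: "'a::ab_group_add set"
  assumes fin: "finite B" and ne: "B \<noteq> {}" and d: "d \<noteq> 0"
    and diff: "\<And>x y. x \<in> B \<Longrightarrow> y \<in> B \<Longrightarrow> \<exists>i. \<bar>i\<bar> < int (card B) \<and> x - y = i \<cdot>\<^sub>z d"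
    and small: "enat (2 * card B) < min_subgroup_order TYPE('a)"
  shows "arithmetic_progression B"
proof -
  define n where "n = card B"
  have nz: "i \<cdot>\<^sub>z d \<noteq> 0" if "0 < i" "i \<le> 2 * int n" for i
  proof -
    have "enat (nat i) \<le> enat (2 * card B)" using that by (simp add: n_def)
    then show ?thesis using int_mult_neq_zero[OF d that(1)] small by (meson le_less_trans)
  qed
  obtain b where b: "b \<in> B" using ne by blast
  define I where "I = {i. \<bar>i\<bar> < int n \<and> b + i \<cdot>\<^sub>z d \<in> B}"
  have BI: "B = (\<lambda>i. b + i \<cdot>\<^sub>z d) ` I"
  proof (intro equalityI subsetI)
    fix x assume x: "x \<in> B"
    then obtain i where i: "\<bar>i\<bar> < int n" "x - b = i \<cdot>\<^sub>z d" using diff[OF x b] by (auto simp: n_def)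
    then have "x = b + i \<cdot>\<^sub>z d" by (metis add_diff_cancel_left' diff_add_cancel add.commute)
    then show "x \<in> (\<lambda>i. b + i \<cdot>\<^sub>z d) ` I" using i x by (auto simp: I_def)
  qed (auto simp: I_def)
  have inj: "inj_on (\<lambda>i. b + i \<cdot>\<^sub>z d) I"
  proof (rule inj_onI)
    fix i j assume "i \<in> I" "j \<in> I" "b + i \<cdot>\<^sub>z d = b + j \<cdot>\<^sub>z d"
    then have "(i - j) \<cdot>\<^sub>z d = 0" "(j - i) \<cdot>\<^sub>z d = 0" "\<bar>i\<bar> < int n" "\<bar>j\<bar> < int n"
      by (auto simp: I_def int_mult_diff)
    then show "i = j" using nz[of "i - j"] nz[of "j - i"] by linarith
  qed
  have "\<exists>s. I = {s..<s + int n}"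
  proof (rule int_set_interval)
    show "\<bar>i\<bar> < int n" if "i \<in> I" for i using that by (simp add: I_def)
    show "0 \<in> I" using b fin by (auto simp: I_def n_def card_gt_0_iff)
    show "card I = n" using BI card_image[OF inj] by (simp add: n_def)
    show "i - j \<noteq> int n \<and> i - j \<noteq> int n + 1" if "i \<in> I" "j \<in> I" for i j
    proof -
      have "b + i \<cdot>\<^sub>z d \<in> B" "b + j \<cdot>\<^sub>z d \<in> B" using that by (auto simp: I_def)
      then obtain t where t: "\<bar>t\<bar> < int n" "(b + i \<cdot>\<^sub>z d) - (b + j \<cdot>\<^sub>z d) = t \<cdot>\<^sub>z d"
        using diff unfolding n_def by blast
      then have "(i - j - t) \<cdot>\<^sub>z d = 0" by (simp add: int_mult_diff)
      then have "\<not> (0 < i - j - t \<and> i - j - t \<le> 2 * int n)" using nz by blast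
      then show ?thesis using t(1) by linarith
    qed
  qed
  then obtain s where s: "I = {s..<s + int n}" by blast
  have "B = {(b + s \<cdot>\<^sub>z d) + int i \<cdot>\<^sub>z d | i. i < card B}"
  proof -
    have "I = (\<lambda>i. s + int i) ` {..<n}"
    proof (intro equalityI subsetI)
      fix x assume "x \<in> I"
      then show "x \<in> (\<lambda>i. s + int i) ` {..<n}"
        using s by (intro image_eqI[of _ _ "nat (x - s)"]) auto
    qed (auto simp: s)
    then have "B = (\<lambda>i. (b + s \<cdot>\<^sub>z d) + int i \<cdot>\<^sub>z d) ` {..<n}"
      using BI by (simp add: image_image int_mult_add add.assoc)
    then show ?thesis unfolding n_def by blast
  qed
  then show ?thesis using d unfolding arithmetic_progression_def by blast
qed

lemma singleton_progression:
  assumes "(UNIV :: 'a::ab_group_add set) \<noteq> {0}"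
  shows "arithmetic_progression {b :: 'a}"
proof -
  obtain d :: 'a where "d \<noteq> 0" using assms by auto
  then show ?thesis
    unfolding arithmetic_progression_def by (intro exI[of _ b] exI[of _ d]) auto
qed

lemma symmetric_small_doubling_progression:
  fixes B :: "'a::ab_group_add set"
  assumes fin: "finite B" and two: "2 \<le> card B" and sym: "\<And>b. b \<in> B \<Longrightarrow> - b \<in> B"
    and le: "card (B + B) + 1 \<le> 2 * card B"
    and small: "enat (2 * card B) < min_subgroup_order TYPE('a)"
  shows "arithmetic_progression B"
proof -
  have ne: "B \<noteq> {}" using two by auto
  have "enat (card (B + B)) \<le> enat (2 * card B)" using le by simp
  then have small2: "enat (card (B + B)) < min_subgroup_order TYPE('a)"
    using small by (rule le_less_trans)
  have "card B + card B \<le> card (B + B) + 1"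
    using cauchy_davenport[of B B] fin ne small2 by simp
  then have eq: "card (B + B) + 1 = card B + card B" using le by linarith
  have ap: "arithmetic_progression (B + B)"
    by (rule vosper_sumset[OF fin fin two two eq small2])
  define n where "n = card B - 1"
  have n: "card B = n + 1" using two by (simp add: n_def)
  obtain b where "b \<in> B" using ne by blast
  then have "b + (- b) \<in> B + B" using sym by (intro set_plus_intro)
  then have zero: "0 \<in> B + B" by simp
  have symS: "- s \<in> B + B" if s: "s \<in> B + B" for s
  proof -
    obtain x y where "s = x + y" "x \<in> B" "y \<in> B" using s by (rule set_plus_elim)
    then show ?thesis using set_plus_intro[OF sym sym, of x y] by (simp add: add.commute)
  qed
  have "enat (2 * n + 1) < min_subgroup_order TYPE('a)"
  proof -
    have "card (B + B) = 2 * n + 1" using eq n by linarith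
    then show ?thesis using small2 by simp
  qed
  then obtain d where d: "d \<noteq> 0" "B + B = {i \<cdot>\<^sub>z d | i. \<bar>i\<bar> \<le> int n}"
    using symmetric_progression_centred[OF ap, of n] eq n zero symS by auto
  show ?thesis
  proof (rule progression_of_difference_set[OF fin ne d(1) _ small])
    fix x y assume "x \<in> B" "y \<in> B"
    then have "x + (- y) \<in> B + B" using sym by (intro set_plus_intro)
    then show "\<exists>i. \<bar>i\<bar> < int (card B) \<and> x - y = i \<cdot>\<^sub>z d" using d(2) n by force
  qed
qed

section \<open>Iterated and signed sumsets\<close>
primrec iterated_sumset :: "nat \<Rightarrow> 'a::ab_group_add set \<Rightarrow> 'a set" where
  "iterated_sumset 0 B = {0}"
| "iterated_sumset (Suc h) B = iterated_sumset h B + B"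

lemma finite_iterated_sumset: "finite B \<Longrightarrow> finite (iterated_sumset h B)"
  by (induction h) (simp_all add: finite_set_plus)

lemma iterated_sumset_nonempty: "B \<noteq> {} \<Longrightarrow> iterated_sumset h B \<noteq> {}"
  by (induction h) (auto simp: set_plus_def)

lemma iterated_sumset_two: "iterated_sumset 2 B = B + B"
  by (simp add: numeral_2_eq_2)

lemma card_iterated_sumset_ge:
  fixes B :: "'a::ab_group_add set"
  assumes fin: "finite B" and ne: "B \<noteq> {}" and h: "2 \<le> h"
    and small: "enat (card (iterated_sumset h B)) < min_subgroup_order TYPE('a)"
  shows "card (B + B) + (h - 2) * (card B - 1) \<le> card (iterated_sumset h B)"
  using h small
proof (induction h rule: dec_induct)
  case base
  show ?case by (simp only: iterated_sumset_two) simp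
next
  case (step h)
  let ?S = "iterated_sumset h B"
  have S: "finite ?S" "?S \<noteq> {}"
    using fin ne by (simp_all add: finite_iterated_sumset iterated_sumset_nonempty)
  have "card ?S \<le> card (?S + B)" using card_le_card_sumset S fin ne by blast
  then have "enat (card ?S) < min_subgroup_order TYPE('a)"
    using step.prems by (metis enat_ord_simps(1) iterated_sumset.simps(2) le_less_trans)
  then have IH: "card (B + B) + (h - 2) * (card B - 1) \<le> card ?S" by (rule step.IH)
  have "card ?S + card B \<le> card (?S + B) + 1"
    using step.prems by (intro cauchy_davenport S fin ne) simp
  moreover have "card B \<noteq> 0" using fin ne by simp
  ultimately have "card (B + B) + ((h - 2) * (card B - 1) + (card B - 1)) \<le> card (?S + B)"
    using IH by linarith
  moreover have "Suc h - 2 = Suc (h - 2)" using step.hyps by simp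
  ultimately show ?case by (simp only: iterated_sumset.simps mult_Suc add.commute[of "card B - 1"])
qed

text \<open>The bound on the individual coefficients follows from the bound on their absolute sum.\<close>
lemma signed_sumset_iff:
  fixes A :: "'a::ab_group_add set"
  assumes "finite A"
  shows "s \<in> signed_sumset h A \<longleftrightarrow>
    (\<exists>l :: 'a \<Rightarrow> int. s = (\<Sum>a\<in>A. l a \<cdot>\<^sub>z a) \<and> (\<Sum>a\<in>A. \<bar>l a\<bar>) = int h)"
proof -
  have "l a \<in> {- int h..int h}" if "(\<Sum>a\<in>A. \<bar>l a\<bar>) = int h" "a \<in> A" for l :: "'a \<Rightarrow> int" and a
    using member_le_sum[of a A "\<lambda>a. \<bar>l a\<bar>"] that assms by auto
  then show ?thesis unfolding signed_sumset_def by blast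
qed

lemma sum_fun_upd:
  fixes F :: "'a \<Rightarrow> 'b \<Rightarrow> 'c::ab_group_add"
  assumes "finite A" "c \<in> A"
  shows "(\<Sum>a\<in>A. F a ((l(c := v)) a)) = (\<Sum>a\<in>A. F a (l a)) + (F c v - F c (l c))"
proof -
  have "(\<Sum>a\<in>A - {c}. F a ((l(c := v)) a)) = (\<Sum>a\<in>A - {c}. F a (l a))"
    by (rule sum.cong) auto
  then show ?thesis using assms by (simp add: sum.remove[of A c])
qed

text \<open>
  The coefficients \<open>u\<close> of \<open>c\<close> and \<open>v\<close> of \<open>- c\<close> contribute \<open>(u - v) c\<close>. They can therefore be changed
  at will as long as \<open>u - v\<close> is kept, and \<open>|u| + |v|\<close> can be raised by exactly two. If \<open>c = - c\<close> there
  is only one coefficient, but it matters only modulo \<open>2\<close>.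
\<close>
lemma signed_sumset_add_two:
  fixes A :: "'a::ab_group_add set"
  assumes fin: "finite A" and c: "c \<in> A" "- c \<in> A" and s: "s \<in> signed_sumset h A"
  shows "s \<in> signed_sumset (h + 2) A"
proof -
  obtain l :: "'a \<Rightarrow> int" where l: "s = (\<Sum>a\<in>A. l a \<cdot>\<^sub>z a)" "(\<Sum>a\<in>A. \<bar>l a\<bar>) = int h"
    using s signed_sumset_iff[OF fin] by blast
  show ?thesis
  proof (cases "c = - c")
    case True
    then have c2: "c + c = 0" by (metis add.right_inverse)
    define v where "v = (if l c \<ge> 0 then l c + 2 else l c - 2)"
    have "2 \<cdot>\<^sub>z c = 0" using int_mult_add[of 1 1 c] c2 by simp
    then have "v \<cdot>\<^sub>z c = l c \<cdot>\<^sub>z c" by (simp add: v_def int_mult_add int_mult_diff)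
    then have "s = (\<Sum>a\<in>A. (l(c := v)) a \<cdot>\<^sub>z a)"
      using l sum_fun_upd[OF fin c(1), of "\<lambda>a k. k \<cdot>\<^sub>z a" l v] by simp
    moreover have "(\<Sum>a\<in>A. \<bar>(l(c := v)) a\<bar>) = int (h + 2)"
      using l sum_fun_upd[OF fin c(1), of "\<lambda>a k. \<bar>k\<bar>" l v] by (simp add: v_def)
    ultimately show ?thesis using signed_sumset_iff[OF fin] by blast
  next
    case False
    obtain u v :: int where uv: "u - v = l c - l (- c)" "\<bar>u\<bar> + \<bar>v\<bar> = \<bar>l c\<bar> + \<bar>l (- c)\<bar> + 2"
    proof -
      consider "l c \<ge> 0 \<and> l (- c) \<ge> 0" | "l c \<le> 0 \<and> l (- c) \<le> 0"
        | "l c \<ge> 0 \<and> l (- c) \<le> 0" | "l c \<le> 0 \<and> l (- c) \<ge> 0" by linarith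
      then show thesis
      proof cases
        case 1 then show ?thesis by (intro that[of "l c + 1" "l (- c) + 1"]) auto
      next
        case 2 then show ?thesis by (intro that[of "l c - 1" "l (- c) - 1"]) auto
      next
        case 3 then show ?thesis by (intro that[of "l c - l (- c) + 1" 1]) auto
      next
        case 4 then show ?thesis by (intro that[of 1 "1 - (l c - l (- c))"]) auto
      qed
    qed
    define l' where "l' = (l(c := u))(- c := v)"
    have "(\<Sum>a\<in>A. l' a \<cdot>\<^sub>z a) = s + (u \<cdot>\<^sub>z c - l c \<cdot>\<^sub>z c) + (v \<cdot>\<^sub>z (- c) - l (- c) \<cdot>\<^sub>z (- c))"
      using l False sum_fun_upd[OF fin c(1), of "\<lambda>a k. k \<cdot>\<^sub>z a" l u]
        sum_fun_upd[OF fin c(2), of "\<lambda>a k. k \<cdot>\<^sub>z a" "l(c := u)" v] by (simp add: l'_def)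
    also have "\<dots> = s + ((u - v) \<cdot>\<^sub>z c - (l c - l (- c)) \<cdot>\<^sub>z c)"
      by (simp add: int_mult_diff int_mult_right_minus algebra_simps)
    finally have "s = (\<Sum>a\<in>A. l' a \<cdot>\<^sub>z a)" using uv by simp
    moreover have "(\<Sum>a\<in>A. \<bar>l' a\<bar>) = int (h + 2)"
      using l False uv sum_fun_upd[OF fin c(1), of "\<lambda>a k. \<bar>k\<bar>" l u]
        sum_fun_upd[OF fin c(2), of "\<lambda>a k. \<bar>k\<bar>" "l(c := u)" v] by (simp add: l'_def)
    ultimately show ?thesis using signed_sumset_iff[OF fin] by blast
  qed
qed

text \<open>
  Adding one more \<open>\<plusminus> a\<close> changes the weight by \<open>1\<close> or by \<open>- 1\<close>; in the second case the missing two
  units are supplied by the pair \<open>c, - c\<close>.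
\<close>
lemma iterated_sumset_subset_signed_sumset:
  fixes A :: "'a::ab_group_add set"
  assumes fin: "finite A" and c: "c \<in> A" "- c \<in> A"
  shows "iterated_sumset h (A \<union> uminus ` A) \<subseteq> signed_sumset h A"
proof (induction h)
  case 0
  show ?case using signed_sumset_iff[OF fin, of 0 0] by (auto intro!: exI[of _ "\<lambda>_. 0"])
next
  case (Suc h)
  show ?case
  proof
    fix z assume "z \<in> iterated_sumset (Suc h) (A \<union> uminus ` A)"
    then obtain s b where z: "z = s + b" "s \<in> iterated_sumset h (A \<union> uminus ` A)"
      "b \<in> A \<union> uminus ` A" unfolding iterated_sumset.simps by (rule set_plus_elim)
    obtain a :: 'a and \<epsilon> :: int where a: "a \<in> A" "b = \<epsilon> \<cdot>\<^sub>z a" "\<epsilon> = 1 \<or> \<epsilon> = -1"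
      using z(3) by (metis Un_iff imageE int_mult_minus int_mult_one)
    obtain l :: "'a \<Rightarrow> int" where l: "s = (\<Sum>a\<in>A. l a \<cdot>\<^sub>z a)" "(\<Sum>a\<in>A. \<bar>l a\<bar>) = int h"
      using z Suc.IH signed_sumset_iff[OF fin] by blast
    define l' where "l' = l(a := l a + \<epsilon>)"
    have zl: "z = (\<Sum>a\<in>A. l' a \<cdot>\<^sub>z a)"
      using l z a sum_fun_upd[OF fin a(1), of "\<lambda>a k. k \<cdot>\<^sub>z a" l "l a + \<epsilon>"]
      by (simp add: l'_def int_mult_add)
    have abs: "(\<Sum>a\<in>A. \<bar>l' a\<bar>) = int h + (\<bar>l a + \<epsilon>\<bar> - \<bar>l a\<bar>)"
      using l sum_fun_upd[OF fin a(1), of "\<lambda>a k. \<bar>k\<bar>" l "l a + \<epsilon>"] by (simp add: l'_def)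
    show "z \<in> signed_sumset (Suc h) A"
    proof (cases "\<bar>l a + \<epsilon>\<bar> = \<bar>l a\<bar> + 1")
      case True
      then show ?thesis using zl abs signed_sumset_iff[OF fin] by fastforce
    next
      case False
      then have "\<bar>l a + \<epsilon>\<bar> = \<bar>l a\<bar> - 1" using a by auto
      then have eq: "(\<Sum>a\<in>A. \<bar>l' a\<bar>) = int h - 1" using abs by simp
      moreover have "0 \<le> (\<Sum>a\<in>A. \<bar>l' a\<bar>)" by (simp add: sum_nonneg)
      ultimately have "(\<Sum>a\<in>A. \<bar>l' a\<bar>) = int (h - 1)" "Suc h = (h - 1) + 2" by auto
      then show ?thesis
        using zl signed_sumset_iff[OF fin] signed_sumset_add_two[OF fin c] by metis
    qed
  qed
qed

theorem theorem3p2: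
  fixes A :: "'a::ab_group_add set" and h m :: nat
  assumes nontrivial: "(UNIV :: 'a set) \<noteq> {0}"
    and h: "h \<ge> 2" and m: "m \<ge> 1"
    and A: "finite A" "card A = m"
    and meets: "A \<inter> uminus ` A \<noteq> {}"
  shows
    "(int (card (signed_sumset 2 A)) = 4 * int m - 2 * int (card (A \<inter> uminus ` A)) - 1 \<and>
      enat (card (signed_sumset 2 A)) < min_subgroup_order TYPE('a) - 1 \<longrightarrow>
      arithmetic_progression (A \<union> uminus ` A)) \<and>
     (h \<ge> 3 \<and>
      int (card (signed_sumset h A)) =
        2 * int h * int m - int h * int (card (A \<inter> uminus ` A)) - int h + 1 \<and>
      enat (card (signed_sumset h A)) < min_subgroup_order TYPE('a) \<longrightarrow>
      arithmetic_progression (A \<union> uminus ` A))"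
proof -
  let ?p = "min_subgroup_order TYPE('a)"
  define B where "B = A \<union> uminus ` A"
  have fin: "finite B" and ne: "B \<noteq> {}" and sym: "\<And>b. b \<in> B \<Longrightarrow> - b \<in> B"
    using A meets by (auto simp: B_def)
  obtain c where c: "c \<in> A" "- c \<in> A" using meets by auto
  have "card B + card (A \<inter> uminus ` A) = 2 * m"
    using card_Un_Int[of A "uminus ` A"] A by (simp add: B_def card_image)
  then have n: "2 * int m = int (card B) + int (card (A \<inter> uminus ` A))" by simp
  have pos: "1 \<le> card B" using fin ne by (simp add: Suc_le_eq card_gt_0_iff)
  have le: "card (iterated_sumset k B) \<le> card (signed_sumset k A)"
    if "card (signed_sumset k A) > 0" for k
    using that iterated_sumset_subset_signed_sumset[OF A(1) c]
    by (metis B_def card_ge_0_finite card_mono)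
  have progression: "arithmetic_progression B"
    if "card (B + B) + 1 \<le> 2 * card B" "2 \<le> card B \<Longrightarrow> enat (2 * card B) < ?p"
  proof (cases "card B = 1")
    case True
    then obtain b where "B = {b}" by (auto simp: card_1_singleton_iff)
    then show ?thesis using singleton_progression[OF nontrivial] by simp
  next
    case False
    then have "2 \<le> card B" using pos by linarith
    then show ?thesis using symmetric_small_doubling_progression[OF fin _ sym] that by blast
  qed
  show ?thesis
    unfolding B_def[symmetric]
  proof (intro conjI impI; elim conjE)
    assume card2: "int (card (signed_sumset 2 A)) = 4 * int m - 2 * int (card (A \<inter> uminus ` A)) - 1"
      and small: "enat (card (signed_sumset 2 A)) < ?p - 1"
    have eq: "card (signed_sumset 2 A) + 1 = 2 * card B" using card2 n by linarith
    then have "card (B + B) + 1 \<le> 2 * card B"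
      using le[of 2] pos unfolding iterated_sumset_two by linarith
    moreover have "enat (2 * card B) < ?p"
      using small eq[symmetric] by (cases ?p) (auto simp: one_enat_def)
    ultimately show "arithmetic_progression B" by (rule progression)
  next
    assume h3: "3 \<le> h"
      and cardh: "int (card (signed_sumset h A)) =
        2 * int h * int m - int h * int (card (A \<inter> uminus ` A)) - int h + 1"
      and small: "enat (card (signed_sumset h A)) < ?p"
    have "2 * int h * int m = int h * (int (card B) + int (card (A \<inter> uminus ` A)))"
      using n by (metis mult.assoc mult.left_commute)
    then have "int (card (signed_sumset h A)) = int h * (int (card B) - 1) + 1"
      using cardh by (simp add: algebra_simps)
    then have eq: "card (signed_sumset h A) = h * (card B - 1) + 1"
      using pos by (metis Suc_eq_plus1 nat_int_comparison(1) of_nat_1 of_nat_Suc of_nat_diff of_nat_mult add.commute)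
    define k where "k = card B - 1"
    have k: "card B = k + 1" using pos by (simp add: k_def)
    obtain g where g: "h = g + 3" using h3 by (metis le_Suc_ex add.commute)
    have leh: "card (iterated_sumset h B) \<le> card (signed_sumset h A)" using le[of h] eq by simp
    then have "enat (card (iterated_sumset h B)) < ?p"
      using small by (meson enat_ord_simps(1) le_less_trans)
    from card_iterated_sumset_ge[OF fin ne h this]
    have "card (B + B) + (g + 1) * k \<le> (g + 3) * k + 1" using leh eq by (simp add: g k_def)
    then have B2: "card (B + B) + 1 \<le> 2 * card B" by (simp add: k algebra_simps)
    show "arithmetic_progression B"
    proof (rule progression[OF B2])
      (* The bound on the h-fold sumset is at least 3 (n - 1) + 1, which reaches 2 n
         exactly when n is at least 2. *)
      assume "2 \<le> card B"
      then have "1 * 1 \<le> k" by (simp add: k)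
      then have "2 * card B \<le> 3 * k + 1" by (simp add: k)
      also have "\<dots> \<le> card (signed_sumset h A)" unfolding eq by (simp add: g k)
      finally have "enat (2 * card B) \<le> enat (card (signed_sumset h A))" by simp
      then show "enat (2 * card B) < ?p" using small by (rule le_less_trans)
    qed
  qed
qed

end
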